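(* Let the error process $(\Xi_t)_{t\in[0,1]}$ in the experiments $\mathfrak E_{1,n}$ and $\mathfrak E_{2,n}$ defined in the context be a Brownian bridge. Then for every $\beta>0$, every $L>0$ and all $n\in\mathbb N$ (with $n\ge1$), $$\delta\bigl(\mathfrak E_{1,n}(\Theta(\beta,L)),\mathfrak E_{2,n}(\Theta(\beta,L))\bigr)\ge \tfrac14,$$ where $\Theta(\beta,L)$ is the Sobolev ellipsoid defined in the context. In particular, the sequences $(\mathfrak E_{1,n}(\Theta(\beta,L)))_{n\in\mathbb N}$ and $(\mathfrak E_{2,n}(\Theta(\beta,L)))_{n\in\mathbb N}$ are not asymptotically equivalent, i.e. $\Delta(\mathfrak E_{1,n}(\Theta(\beta,L)),\mathfrak E_{2,n}(\Theta(\beta,L)))$ does not converge to $0$.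
   Context: Brownian bridge. The centered Gaussian process on $[0,1]$ with continuous paths and covariance $\operatorname{Cov}(\Xi_s,\Xi_t)=s(1-t)$ for $0\le s\le t\le1$. Sobolev ellipsoid. With $\mathbf e_k(x)=\exp(-2\pi\mathrm i kx)$, $k\in\mathbb Z$, $$\Theta(\beta,L)=\Bigl\{f(\cdot)=\sum_{k=-\infty}^{\infty}\theta_k\mathbf e_k(\cdot):\ \theta_k=\overline{\theta_{-k}}\ \text{ and }\ \sum_{k=-\infty}^\infty(1+|k|)^{2\beta}|\theta_k|^2\le L^2\Bigr\},$$ a set of real-valued functions on $[0,1]$, the series converging in $L^2([0,1])$. The value $f(x)$ is the limit of the symmetric partial sums $\sum_{|k|\le N}\theta_k\mathbf e_k(x)$ where this limit exists (for $\beta>1/2$ it exists everywhere and $f$ is continuous), and $0$ otherwise. Experiments. Let $t_{i,n}=i/n$. For a class $\Theta$ of functions, $\mathfrak E_{1,n}(\Theta)=(\mathbb R^n,\mathcal B(\mathbb R^n),(\mathbf P^f_{1,n})_{f\in\Theta})$, where $\mathbf P^f_{1,n}$ is the law of $(Y_{1,n},\dots,Y_{n,n})$ with $Y_{i,n}=f(t_{i,n})+\sqrt n\,(\Xi_{t_{i,n}}-\Xi_{t_{i-1,n}})$, $i=1,\dots,n$. $\mathfrak E_{2,n}(\Theta)=(C([0,1],\mathbb R),\mathcal B(C([0,1],\mathbb R)),(\mathbf P^f_{2,n})_{f\in\Theta})$, where $\mathbf P^f_{2,n}$ is the law of the process $Y_t=\int_0^t f(s)\,\mathrm ds+\frac1{\sqrt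 n}\Xi_t$, $t\in[0,1]$. Deficiency and Le Cam distance. For two experiments $\mathfrak E_i=(\mathcal X_i,\mathscr X_i,(\mathbf P_{i,\theta})_{\theta\in\Theta})$, $i=1,2$, with the same parameter set, $\delta(\mathfrak E_1,\mathfrak E_2)=\inf_K\sup_{\theta\in\Theta}\|K\mathbf P_{1,\theta}-\mathbf P_{2,\theta}\|_{\mathrm{TV}}$, the infimum being over all Markov kernels $K:\mathcal X_1\times\mathscr X_2\to[0,1]$, where $K\mathbf P(A)=\int K(x,A)\,\mathbf P(\mathrm dx)$ and $\|\mathbf P-\mathbf Q\|_{\mathrm{TV}}=\sup_A|\mathbf P(A)-\mathbf Q(A)|$; and $\Delta(\mathfrak E_1,\mathfrak E_2)=\max\{\delta(\mathfrak E_1,\mathfrak E_2),\delta(\mathfrak E_2,\mathfrak E_1)\}$. *)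

theory Defs
  imports "HOL-Probability.Probability"
begin

section \<open>The Brownian bridge\<close>

text \<open>Point masses count as (degenerate) Gaussian laws; the bridge vanishes at the endpoints.\<close>

definition gaussian_rv :: "'a measure \<Rightarrow> ('a \<Rightarrow> real) \<Rightarrow> bool" where
  "gaussian_rv M X \<longleftrightarrow>
     X \<in> borel_measurable M \<and>
     ((\<exists>\<mu> \<sigma>. \<sigma> > 0 \<and> distributed M lborel X (\<lambda>x. ennreal (normal_density \<mu> \<sigma> x))) \<or>
      (\<exists>\<mu>. AE \<omega> in M. X \<omega> = \<mu>))"

definition gaussian_process :: "'a measure \<Rightarrow> real set \<Rightarrow> (real \<Rightarrow> 'a \<Rightarrow> real) \<Rightarrow> bool" where
  "gaussian_process M T X \<longleftrightarrow>
     (\<forall>J c. finite J \<and> J \<subseteq> T \<longrightarrow> gaussian_rv M (\<lambda>\<omega>. \<Sum>t\<in>J. c t * X t \<omega>))"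

definition covariance :: "'a measure \<Rightarrow> ('a \<Rightarrow> real) \<Rightarrow> ('a \<Rightarrow> real) \<Rightarrow> real" where
  "covariance M X Y =
     (LINT \<omega>|M. (X \<omega> - (LINT \<omega>'|M. X \<omega>')) * (Y \<omega> - (LINT \<omega>'|M. Y \<omega>')))"

definition brownian_bridge :: "'a measure \<Rightarrow> (real \<Rightarrow> 'a \<Rightarrow> real) \<Rightarrow> bool" where
  "brownian_bridge M \<Xi> \<longleftrightarrow>
     prob_space M \<and>
     gaussian_process M {0..1} \<Xi> \<and>
     (\<forall>t\<in>{0..1}. (LINT \<omega>|M. \<Xi> t \<omega>) = 0) \<and>
     (\<forall>s t. 0 \<le> s \<and> s \<le> t \<and> t \<le> 1 \<longrightarrow> covariance M (\<Xi> s) (\<Xi> t) = s * (1 - t)) \<and>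
     (\<forall>\<omega>\<in>space M. continuous_on {0..1} (\<lambda>t. \<Xi> t \<omega>))"


section \<open>The Sobolev ellipsoid\<close>

definition fourier_e :: "int \<Rightarrow> real \<Rightarrow> complex" where
  "fourier_e k x = exp (- 2 * of_real pi * \<i> * of_int k * of_real x)"

definition fourier_partial :: "(int \<Rightarrow> complex) \<Rightarrow> nat \<Rightarrow> real \<Rightarrow> complex" where
  "fourier_partial \<theta> N x = (\<Sum>k\<in>{- int N..int N}. \<theta> k * fourier_e k x)"

text \<open>
  The symmetric partial sums are real when \<^term>\<open>\<theta> k = cnj (\<theta> (- k))\<close>, so taking the real part
  of the limit only changes the type.
\<close>

definition fourier_value :: "(int \<Rightarrow> complex) \<Rightarrow> real \<Rightarrow> real" where
  "fourier_value \<theta> x =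
     (if convergent (\<lambda>N. fourier_partial \<theta> N x) then Re (lim (\<lambda>N. fourier_partial \<theta> N x)) else 0)"

text \<open>
  Functions on the unit interval are represented as extensional functions on \<^term>\<open>{0..1::real}\<close>.
\<close>

definition sobolev_ellipsoid :: "real \<Rightarrow> real \<Rightarrow> (real \<Rightarrow> real) set" where
  "sobolev_ellipsoid \<beta> L =
     {f. \<exists>\<theta>. (\<forall>k. \<theta> k = cnj (\<theta> (- k))) \<and>
          (\<lambda>k. (1 + \<bar>of_int k\<bar>) powr (2 * \<beta>) * (cmod (\<theta> k))\<^sup>2) summable_on UNIV \<and>
          (\<Sum>\<^sub>\<infinity>k. (1 + \<bar>of_int k\<bar>) powr (2 * \<beta>) * (cmod (\<theta> k))\<^sup>2) \<le> L\<^sup>2 \<and>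
          f = restrict (fourier_value \<theta>) {0..1} \<and>
          (\<lambda>N. \<integral>\<^sup>+x\<in>{0..1}. ennreal ((cmod (fourier_partial \<theta> N x - of_real (f x)))\<^sup>2) \<partial>lborel)
            \<longlonglongrightarrow> 0}"


section \<open>Statistical experiments\<close>

text \<open>
  The measure \<open>sample_space\<close> matters only through its carrier and its sigma-algebra; every law
  is a probability measure on that sigma-algebra.
\<close>

record ('p, 'x) stat_experiment =
  parameters :: "'p set"
  sample_space :: "'x measure"
  law :: "'p \<Rightarrow> 'x measure"

definition tv_dist :: "'x measure \<Rightarrow> 'x measure \<Rightarrow> ennreal" where
  "tv_dist P Q = (SUP A\<in>sets P. ennreal \<bar>measure P A - measure Q A\<bar>)"

text \<open>
  A Markov kernel is a measurable map into the probability measures on the target space (Giry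
  monad), and \<open>bind\<close> is the mixture \<open>K P (A) = \<integral> K(x, A) P(dx)\<close>. Both experiments are
  understood to have the same parameter set.
\<close>

definition deficiency :: "('p, 'x) stat_experiment \<Rightarrow> ('p, 'y) stat_experiment \<Rightarrow> ennreal" where
  "deficiency E F =
     (INF K\<in>sample_space E \<rightarrow>\<^sub>M prob_algebra (sample_space F).
        SUP \<theta>\<in>parameters E. tv_dist (Giry_Monad.bind (law E \<theta>) K) (law F \<theta>))"

definition le_cam_dist :: "('p, 'x) stat_experiment \<Rightarrow> ('p, 'y) stat_experiment \<Rightarrow> ennreal" where
  "le_cam_dist E F = max (deficiency E F) (deficiency F E)"


section \<open>The two experiments\<close>

definition borel_of :: "'x topology \<Rightarrow> 'x measure" where
  "borel_of X = sigma (topspace X) {U. openin X U}"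

text \<open>The space of continuous functions on the unit interval with the supremum metric.\<close>

definition C01 :: "(real \<Rightarrow> real) metric" where
  "C01 = cfunspace (top_of_set {0..1}) euclidean_metric"

text \<open>
  Both experiments are built from a realisation \<open>\<Xi>\<close> of the error process on \<open>M\<close>.
  The Euclidean space of dimension \<open>n\<close> is the product over the index set \<^term>\<open>{1..n::nat}\<close>.
\<close>

definition regression_experiment ::
    "'a measure \<Rightarrow> (real \<Rightarrow> 'a \<Rightarrow> real) \<Rightarrow> nat \<Rightarrow> (real \<Rightarrow> real) set
       \<Rightarrow> (real \<Rightarrow> real, nat \<Rightarrow> real) stat_experiment" where
  "regression_experiment M \<Xi> n \<Theta> =
     \<lparr>parameters = \<Theta>,
      sample_space = (\<Pi>\<^sub>M i\<in>{1..n}. borel),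
      law = (\<lambda>f. distr M (\<Pi>\<^sub>M i\<in>{1..n}. borel)
               (\<lambda>\<omega>. \<lambda>i\<in>{1..n}. f (real i / real n)
                  + sqrt (real n) * (\<Xi> (real i / real n) \<omega> - \<Xi> ((real i - 1) / real n) \<omega>)))\<rparr>"

definition continuous_experiment ::
    "'a measure \<Rightarrow> (real \<Rightarrow> 'a \<Rightarrow> real) \<Rightarrow> nat \<Rightarrow> (real \<Rightarrow> real) set
       \<Rightarrow> (real \<Rightarrow> real, real \<Rightarrow> real) stat_experiment" where
  "continuous_experiment M \<Xi> n \<Theta> =
     \<lparr>parameters = \<Theta>,
      sample_space = borel_of (mtopology_of C01),
      law = (\<lambda>f. distr M (borel_of (mtopology_of C01))
               (\<lambda>\<omega>. \<lambda>t\<in>{0..1}. (LINT s:{0..t}|lborel. f s) + 1 / sqrt (real n) * \<Xi> t \<omega>))\<rparr>"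

end

(* The bridge vanishes at time 1, so the continuous experiment reveals the integral of f over
   {0..1} without error, whereas the regression experiment sees f only at the design points.
   The functions 0 and c (1 - cos (2 pi n x)) agree at all design points i/n but have integrals
   0 and c. Hence they induce the same law in the regression experiment and mutually singular
   laws in the continuous one, and no kernel can come closer than 1/2 to both. *)

theory Submission
  imports Defs
begin

section \<open>Two-point lower bound for the deficiency, and image measures\<close>

text \<open>Equal source laws are sent by any kernel to the same \<open>P\<close>. Two disjoint
  events cannot both have \<open>P\<close>-mass above 1/2, so \<open>P\<close> misses one of the
  target laws by at least 1/2. The first alternative in \<open>null_or_1\<close> admits a null
  target law, which is at distance 1 from \<open>P\<close>.\<close>

lemma deficiency_ge_half:
  assumes p: "\<theta>0 \<in> parameters E" "\<theta>1 \<in> parameters E"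
    and eq: "law E \<theta>0 = law E \<theta>1"
    and law: "law E \<theta>0 \<in> space (prob_algebra (sample_space E))"
    and A: "A0 \<in> sets (sample_space F)" "A1 \<in> sets (sample_space F)" "A0 \<inter> A1 = {}"
    and null_or_1: "measure (law F \<theta>0) (space (sample_space F)) = 0 \<or> measure (law F \<theta>0) A0 = 1"
      "measure (law F \<theta>1) (space (sample_space F)) = 0 \<or> measure (law F \<theta>1) A1 = 1"
  shows "ennreal (1 / 2) \<le> deficiency E F"
  unfolding deficiency_def
proof (rule INF_greatest)
  fix K assume K: "K \<in> sample_space E \<rightarrow>\<^sub>M prob_algebra (sample_space F)"
  define P where "P = Giry_Monad.bind (law E \<theta>0) K"
  interpret P: prob_space P
    unfolding P_def using law K by (rule prob_space_bind')
  have sets_P: "sets P = sets (sample_space F)"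
    unfolding P_def using law K by (rule sets_bind')
  have "measure P A0 + measure P A1 = measure P (A0 \<union> A1)"
    using A sets_P by (simp add: P.finite_measure_Union)
  then have "measure P A0 + measure P A1 \<le> 1"
    using P.prob_le_1[of "A0 \<union> A1"] by simp
  \<comment> \<open>Pick the parameter whose event is the light one under \<open>P\<close>.\<close>
  then obtain \<theta> B where \<theta>: "\<theta> \<in> {\<theta>0, \<theta>1}" and B: "B \<in> sets P" "measure P B \<le> 1 / 2"
    and d: "measure (law F \<theta>) (space (sample_space F)) = 0 \<or> measure (law F \<theta>) B = 1"
    using that[of \<theta>0 A0] that[of \<theta>1 A1] A null_or_1 sets_P
    by (cases "measure P A0 \<le> 1 / 2") auto
  have "\<exists>C\<in>sets P. 1 / 2 \<le> \<bar>measure P C - measure (law F \<theta>) C\<bar>"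
    using d
  proof
    assume "measure (law F \<theta>) (space (sample_space F)) = 0"
    then show ?thesis
      using P.prob_space sets_eq_imp_space_eq[OF sets_P]
      by (intro bexI[of _ "space P"] sets.top) simp
  next
    assume "measure (law F \<theta>) B = 1"
    then show ?thesis
      using B by (intro bexI[of _ B]) auto
  qed
  then have "ennreal (1 / 2) \<le> tv_dist P (law F \<theta>)"
    unfolding tv_dist_def by (meson SUP_upper2 ennreal_leI)
  also have "tv_dist P (law F \<theta>) = tv_dist (Giry_Monad.bind (law E \<theta>) K) (law F \<theta>)"
    using \<theta> eq by (auto simp: P_def)
  also have "\<dots> \<le> (SUP \<theta>\<in>parameters E. tv_dist (Giry_Monad.bind (law E \<theta>) K) (law F \<theta>))"
    using \<theta> p by (intro SUP_upper) auto
  finally show "ennreal (1 / 2)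
      \<le> (SUP \<theta>\<in>parameters E. tv_dist (Giry_Monad.bind (law E \<theta>) K) (law F \<theta>))" .
qed

text \<open>
  If the map is not measurable, \<^const>\<open>distr\<close> may be the null measure. Keeping that case open
  makes it unnecessary to show that the Borel sets of \<^const>\<open>C01\<close> are generated by the evaluations.
\<close>

lemma distr_null_or_vimage:
  "measure (distr M N f) (space N) = 0 \<or>
   (\<forall>A\<in>sets N. measure (distr M N f) A = measure M (f -` A \<inter> space M))"
proof -
  \<comment> \<open>\<open>measure_of\<close> falls back to the null measure when the given set
    function is not a measure; this yields the two alternatives.\<close>
  have "emeasure (distr M N f) A =
      (if A \<in> sets N \<and> measure_space (space N) (sets N) (\<lambda>A. emeasure M (f -` A \<inter> space M))
       then emeasure M (f -` A \<inter> space M) else 0)" for A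
    unfolding distr_def by (simp add: emeasure_measure_of_conv sets.space_closed sets.sigma_sets_eq)
  then show ?thesis
    by (auto simp: measure_def)
qed

section \<open>Evaluations on the space of continuous functions\<close>

text \<open>Boundedness, part of the definition of \<open>cfunspace\<close>, is automatic because
  the unit interval is compact.\<close>

lemma mspace_C01: "mspace C01 = {g. g \<in> extensional {0..1} \<and> continuous_on {0..1} g}"
  unfolding C01_def by (subst compactin_mspace_cfunspace) auto

text \<open>Evaluation at a point is 1-Lipschitz for the supremum metric.\<close>

lemma continuous_map_C01_eval:
  assumes "t \<in> {0..1}"
  shows "continuous_map (mtopology_of C01) euclideanreal (\<lambda>g. g t)"
proof -
  have "Lipschitz_continuous_map C01 euclidean_metric (\<lambda>g. g t)"
    unfolding Lipschitz_continuous_map_def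
  proof (intro conjI exI[of _ 1] ballI)
    fix g h assume "g \<in> mspace C01" "h \<in> mspace C01"
    then show "mdist euclidean_metric (g t) (h t) \<le> 1 * mdist C01 g h"
      using mdist_cfunspace_imp_mdist_le[of g "top_of_set {0..1}" euclidean_metric h
          "mdist C01 g h" t] assms
      unfolding C01_def by auto
  qed auto
  then show ?thesis
    using Lipschitz_imp_uniformly_continuous_map uniformly_continuous_imp_continuous_map
    by fastforce
qed

text \<open>The complement is the preimage of an open set under a continuous evaluation. For
  \<open>t = 1\<close> these are the events that separate the continuous laws.\<close>

lemma sets_C01_eval:
  assumes "t \<in> {0..1}"
  shows "{g \<in> mspace C01. g t = a} \<in> sets (borel_of (mtopology_of C01))"
proof -
  have "openin (mtopology_of C01) {g \<in> topspace (mtopology_of C01). g t \<in> - {a}}"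
    using continuous_map_C01_eval[OF assms] by (rule openin_continuous_map_preimage) auto
  moreover have sp: "{U. openin (mtopology_of C01) U} \<subseteq> Pow (mspace C01)"
    using openin_subset by fastforce
  ultimately have "{g \<in> mspace C01. g t \<noteq> a} \<in> sets (borel_of (mtopology_of C01))"
    by (auto simp: borel_of_def)
  then have "space (borel_of (mtopology_of C01)) - {g \<in> mspace C01. g t \<noteq> a}
      \<in> sets (borel_of (mtopology_of C01))"
    by blast
  also have "space (borel_of (mtopology_of C01)) - {g \<in> mspace C01. g t \<noteq> a} =
      {g \<in> mspace C01. g t = a}"
    using sp by (auto simp: borel_of_def space_measure_of)
  finally show ?thesis .
qed

section \<open>Degenerate Gaussian variables and continuity of integrals\<close>

lemma gaussian_rv_AE_eq_0:
  assumes "prob_space M" and "gaussian_rv M X"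
    and "(LINT \<omega>|M. X \<omega>) = 0" and "covariance M X X = 0"
  shows "AE \<omega> in M. X \<omega> = 0"
proof -
  interpret prob_space M by fact
  consider \<mu> \<sigma> where "\<sigma> > 0" "distributed M lborel X (normal_density \<mu> \<sigma>)"
    | \<mu> where "AE \<omega> in M. X \<omega> = \<mu>"
    using assms(2) by (auto simp: gaussian_rv_def)
  then show ?thesis
  proof cases
    \<comment> \<open>The variance would be \<sigma>^2 > 0, contradicting the vanishing
      covariance.\<close>
    case 1
    then show ?thesis
      using normal_distributed_variance[of \<sigma> X \<mu>] assms(3,4)
      by (simp add: covariance_def power2_eq_square)
  next
    case 2
    have "X \<in> borel_measurable M"
      using assms(2) by (simp add: gaussian_rv_def)
    then have "(LINT \<omega>|M. X \<omega>) = (LINT \<omega>|M. \<mu>)"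
      using 2 by (intro integral_cong_AE) auto
    then show ?thesis
      using 2 assms(3) by (simp add: prob_space)
  qed
qed

text \<open>The Lebesgue integral agrees here with the gauge integral, whose indefinite integrals
  are known to be continuous. This puts the drift of the continuous experiment into
  \<open>C01\<close>.\<close>

lemma continuous_on_set_integral:
  fixes f :: "real \<Rightarrow> real"
  assumes "continuous_on {a..b} f"
  shows "continuous_on {a..b} (\<lambda>t. LINT s:{a..t}|lborel. f s)"
proof -
  have "continuous_on {a..b} (\<lambda>t. integral {a..t} f)"
    using assms by (intro indefinite_integral_continuous_1 integrable_continuous_real)
  moreover have "(LINT s:{a..t}|lborel. f s) = integral {a..t} f" if "t \<in> {a..b}" for t
    using that by (intro set_borel_integral_eq_integral(2) borel_integrable_atLeastAtMost'
        continuous_on_subset[OF assms]) auto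
  ultimately show ?thesis
    by (metis (no_types, lifting) continuous_on_cong)
qed

section \<open>Laws driven by a Brownian bridge\<close>

context
  fixes M :: "'a measure" and \<Xi> :: "real \<Rightarrow> 'a \<Rightarrow> real"
  assumes bridge: "brownian_bridge M \<Xi>"
begin

lemma bridge_prob_space: "prob_space M"
  using bridge by (simp add: brownian_bridge_def)

lemma bridge_gaussian_rv:
  assumes "t \<in> {0..1}"
  shows "gaussian_rv M (\<Xi> t)"
proof -
  have "gaussian_process M {0..1} \<Xi>"
    using bridge by (simp add: brownian_bridge_def)
  \<comment> \<open>A single time with coefficient 1 is a linear combination of the process.\<close>
  from this[unfolded gaussian_process_def, rule_format, of "{t}" "\<lambda>_. 1"] show ?thesis
    using assms by simp
qed

lemma bridge_measurable:
  assumes "t \<in> {0..1}"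
  shows "\<Xi> t \<in> borel_measurable M"
  using bridge_gaussian_rv[OF assms] by (simp add: gaussian_rv_def)

text \<open>The covariance formula at s = t = 1 gives variance 1 * (1 - 1) = 0.\<close>

lemma bridge_1_AE: "AE \<omega> in M. \<Xi> 1 \<omega> = 0"
proof (rule gaussian_rv_AE_eq_0)
  show "(LINT \<omega>|M. \<Xi> 1 \<omega>) = 0"
    using bridge by (simp add: brownian_bridge_def)
  have "0 \<le> (1::real) \<and> (1::real) \<le> 1 \<and> (1::real) \<le> 1 \<longrightarrow>
      covariance M (\<Xi> 1) (\<Xi> 1) = 1 * (1 - 1)"
    using bridge unfolding brownian_bridge_def by blast
  then show "covariance M (\<Xi> 1) (\<Xi> 1) = 0"
    by simp
qed (simp_all add: bridge_prob_space bridge_gaussian_rv)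

lemma regression_law_in_prob_algebra:
  assumes "n \<ge> 1"
  shows "law (regression_experiment M \<Xi> n \<Theta>) f
    \<in> space (prob_algebra (sample_space (regression_experiment M \<Xi> n \<Theta>)))"
proof -
  interpret prob_space M
    by (rule bridge_prob_space)
  have "(\<lambda>\<omega>. \<lambda>i\<in>{1..n}. f (real i / real n)
      + sqrt (real n) * (\<Xi> (real i / real n) \<omega> - \<Xi> ((real i - 1) / real n) \<omega>))
    \<in> M \<rightarrow>\<^sub>M (\<Pi>\<^sub>M i\<in>{1..n}. borel)"
  proof (rule measurable_restrict)
    fix i assume "i \<in> {1..n}"
    then have "\<Xi> (real i / real n) \<in> borel_measurable M"
      "\<Xi> ((real i - 1) / real n) \<in> borel_measurable M"
      by (auto intro!: bridge_measurable simp: field_simps)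
    then show "(\<lambda>\<omega>. f (real i / real n)
        + sqrt (real n) * (\<Xi> (real i / real n) \<omega> - \<Xi> ((real i - 1) / real n) \<omega>))
      \<in> borel_measurable M"
      by measurable
  qed
  then show ?thesis
    by (auto simp: regression_experiment_def space_prob_algebra intro!: prob_space_distr)
qed

text \<open>At time 1 the noise vanishes almost surely, so the path ends at the integral of
  \<open>f\<close>. The null alternative is inherited from
  \<open>distr_null_or_vimage\<close>.\<close>

lemma continuous_law_null_or_1:
  fixes n :: nat
  assumes "continuous_on {0..1} f"
  shows "measure (law (continuous_experiment M \<Xi> n \<Theta>) f) (mspace C01) = 0 \<or>
    measure (law (continuous_experiment M \<Xi> n \<Theta>) f)
      {g \<in> mspace C01. g 1 = (LINT s:{0..1}|lborel. f s)} = 1"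
proof -
  interpret prob_space M
    by (rule bridge_prob_space)
  let ?N = "borel_of (mtopology_of C01)"
  let ?A = "{g \<in> mspace C01. g 1 = (LINT s:{0..1}|lborel. f s)}"
  let ?F = "\<lambda>\<omega>. \<lambda>t\<in>{0..1}. (LINT s:{0..t}|lborel. f s) + 1 / sqrt (real n) * \<Xi> t \<omega>"
  have space: "space ?N = mspace C01"
    by (simp add: borel_of_def space_measure_of_conv)
  have "?F \<omega> \<in> mspace C01" if "\<omega> \<in> space M" for \<omega>
  proof -
    have "continuous_on {0..1} (\<lambda>t. \<Xi> t \<omega>)"
      using bridge that by (simp add: brownian_bridge_def)
    then have "continuous_on {0..1}
        (\<lambda>t. (LINT s:{0..t}|lborel. f s) + 1 / sqrt (real n) * \<Xi> t \<omega>)"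
      using continuous_on_set_integral[OF assms(1)] by (intro continuous_intros)
    then have "continuous_on {0..1} (?F \<omega>)"
      by (rule continuous_on_eq) simp
    then show ?thesis
      by (simp add: mspace_C01)
  qed
  \<comment> \<open>All paths lie in \<open>mspace C01\<close>, so only the condition at time 1
    remains, and there the integral cancels.\<close>
  then have "?F -` ?A \<inter> space M = {\<omega> \<in> space M. 1 / sqrt (real n) * \<Xi> 1 \<omega> = 0}"
    by auto
  moreover have "prob {\<omega> \<in> space M. 1 / sqrt (real n) * \<Xi> 1 \<omega> = 0} = 1"
    using bridge_1_AE bridge_measurable[of 1] by (subst prob_Collect_eq_1) auto
  moreover have "?A \<in> sets ?N"
    by (rule sets_C01_eval) simp
  ultimately show ?thesis
    using distr_null_or_vimage[of M ?N ?F] space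
    by (auto simp: continuous_experiment_def)
qed

text \<open>The regression law depends on the function only through its design values. The
  separating events prescribe the endpoint \<open>g 1\<close>; they are disjoint because the
  integrals differ.\<close>

lemma deficiency_ge_half_if_integrals_differ:
  assumes "n \<ge> 1" and \<Theta>: "f0 \<in> \<Theta>" "f1 \<in> \<Theta>"
    and eq: "\<And>i. i \<in> {1..n} \<Longrightarrow> f0 (real i / real n) = f1 (real i / real n)"
    and cont: "continuous_on {0..1} f0" "continuous_on {0..1} f1"
    and ne: "(LINT s:{0..1}|lborel. f0 s) \<noteq> (LINT s:{0..1}|lborel. f1 s)"
  shows "ennreal (1 / 2)
    \<le> deficiency (regression_experiment M \<Xi> n \<Theta>) (continuous_experiment M \<Xi> n \<Theta>)"
proof (rule deficiency_ge_half)
  let ?E = "regression_experiment M \<Xi> n \<Theta>" and ?F = "continuous_experiment M \<Xi> n \<Theta>"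
  let ?A = "\<lambda>f. {g \<in> mspace C01. g 1 = (LINT s:{0..1}|lborel. f s)}"
  show "f0 \<in> parameters ?E" "f1 \<in> parameters ?E"
    using \<Theta> by (simp_all add: regression_experiment_def)
  show "law ?E f0 = law ?E f1"
    using eq by (auto simp: regression_experiment_def fun_eq_iff restrict_def intro!: distr_cong)
  show "law ?E f0 \<in> space (prob_algebra (sample_space ?E))"
    using \<open>n \<ge> 1\<close> by (rule regression_law_in_prob_algebra)
  have F: "sample_space ?F = borel_of (mtopology_of C01)" "space (sample_space ?F) = mspace C01"
    by (simp_all add: continuous_experiment_def borel_of_def space_measure_of_conv)
  show "?A f0 \<in> sets (sample_space ?F)" "?A f1 \<in> sets (sample_space ?F)"
    by (simp_all add: F sets_C01_eval)
  show "?A f0 \<inter> ?A f1 = {}"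
    using ne by auto
  show "measure (law ?F f0) (space (sample_space ?F)) = 0 \<or> measure (law ?F f0) (?A f0) = 1"
    "measure (law ?F f1) (space (sample_space ?F)) = 0 \<or> measure (law ?F f1) (?A f1) = 1"
    using cont F continuous_law_null_or_1 by simp_all
qed

end

section \<open>Trigonometric polynomials in the Sobolev ellipsoid\<close>

lemma fourier_partial_eq_if_support:
  assumes supp: "\<And>k. \<bar>k\<bar> > int N \<Longrightarrow> \<theta> k = 0" and "n \<ge> N"
  shows "fourier_partial \<theta> n x = fourier_partial \<theta> N x"
  unfolding fourier_partial_def using assms
  by (intro sum.mono_neutral_right) auto

text \<open>With finitely many nonzero coefficients the partial sums are constant from
  \<open>N\<close> on, so both the pointwise and the L2 limits are trivial and the weighted series
  is a finite sum.\<close>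

lemma trig_polynomial_in_sobolev_ellipsoid:
  assumes herm: "\<And>k. \<theta> k = cnj (\<theta> (- k))"
    and supp: "\<And>k. \<bar>k\<bar> > int N \<Longrightarrow> \<theta> k = 0"
    and bound: "(\<Sum>k\<in>{- int N..int N}. (1 + \<bar>of_int k\<bar>) powr (2 * \<beta>) * (cmod (\<theta> k))\<^sup>2) \<le> L\<^sup>2"
    and f: "\<And>x. fourier_partial \<theta> N x = of_real (f x)"
  shows "restrict f {0..1} \<in> sobolev_ellipsoid \<beta> L"
proof -
  let ?w = "\<lambda>k::int. (1 + \<bar>of_int k\<bar>) powr (2 * \<beta>) * (cmod (\<theta> k))\<^sup>2"
  have partial: "fourier_partial \<theta> n x = of_real (f x)" if "n \<ge> N" for n x
    using fourier_partial_eq_if_support[of N \<theta> n x] supp that f by simp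
  have lim: "(\<lambda>n. fourier_partial \<theta> n x) \<longlonglongrightarrow> of_real (f x)" for x
    by (rule tendsto_eventually) (use partial in \<open>auto simp: eventually_sequentially\<close>)
  have val: "fourier_value \<theta> x = f x" for x
    using lim[of x] limI[OF lim[of x]] by (auto simp: fourier_value_def convergent_def)
  have "(?w has_sum (\<Sum>k\<in>{- int N..int N}. ?w k)) UNIV"
    by (rule has_sum_finite_neutralI) (use supp in auto)
  then have "?w summable_on UNIV" "(\<Sum>\<^sub>\<infinity>k. ?w k) = (\<Sum>k\<in>{- int N..int N}. ?w k)"
    by (auto simp: infsumI has_sum_imp_summable)
  moreover have "(\<integral>\<^sup>+x\<in>{0..1}. ennreal ((cmod (fourier_partial \<theta> n x
      - of_real (restrict f {0..1} x)))\<^sup>2) \<partial>lborel) = 0" if "n \<ge> N" for n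
  proof -
    have "(\<integral>\<^sup>+x\<in>{0..1}. ennreal ((cmod (fourier_partial \<theta> n x
        - of_real (restrict f {0..1} x)))\<^sup>2) \<partial>lborel) = (\<integral>\<^sup>+(x::real). 0 \<partial>lborel)"
      using partial[OF that] by (intro nn_integral_cong) (auto simp: indicator_def)
    then show ?thesis
      by simp
  qed
  then have "(\<lambda>n. \<integral>\<^sup>+x\<in>{0..1}. ennreal ((cmod (fourier_partial \<theta> n x
      - of_real (restrict f {0..1} x)))\<^sup>2) \<partial>lborel) \<longlonglongrightarrow> 0"
    by (intro tendsto_eventually) (auto simp: eventually_sequentially)
  moreover have "restrict f {0..1} = restrict (fourier_value \<theta>) {0..1}"
    by (simp add: val cong: restrict_cong)
  ultimately show ?thesis
    unfolding sobolev_ellipsoid_def using bound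
    by (intro CollectI exI[of _ \<theta>] conjI allI herm) simp_all
qed

text \<open>The imaginary sine parts of opposite frequencies cancel.\<close>

lemma fourier_e_add_uminus:
  "fourier_e k x + fourier_e (- k) x = of_real (2 * cos (2 * pi * of_int k * x))"
  by (simp add: fourier_e_def complex_eq_iff Re_exp Im_exp)

lemma zero_in_sobolev_ellipsoid: "restrict (\<lambda>_. 0) {0..1} \<in> sobolev_ellipsoid \<beta> L"
  by (rule trig_polynomial_in_sobolev_ellipsoid[of "\<lambda>_. 0" 0]) (auto simp: fourier_partial_def)

text \<open>The only nonzero coefficients are \<open>c\<close> at 0 and \<open>- c / 2\<close> at
  the frequencies n and -n. The amplitude shrinks like (1 + n)^(-\<beta>) to offset the Sobolev
  weight at frequency n.\<close>

lemma bump_in_sobolev_ellipsoid: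
  fixes L :: real
  assumes "n \<ge> 1" and "\<beta> \<ge> 0"
  defines "c \<equiv> L / (2 * (1 + real n) powr \<beta>)"
  shows "(\<lambda>x\<in>{0..1}. c * (1 - cos (2 * pi * real n * x))) \<in> sobolev_ellipsoid \<beta> L"
proof (rule trig_polynomial_in_sobolev_ellipsoid)
  define \<theta> :: "int \<Rightarrow> complex" where
    "\<theta> k = (if k = 0 then of_real c else if \<bar>k\<bar> = int n then - of_real c / 2 else 0)" for k
  define W where "W = (1 + real n) powr (2 * \<beta>)"
  \<comment> \<open>The value type stays general: this serves both the real weighted sum and the
    complex Fourier sum. The three indices are distinct since \<open>n \<ge> 1\<close>.\<close>
  have supp: "sum g {- int n..int n} = g 0 + g (int n) + g (- int n)"
    if "\<And>k. \<theta> k = 0 \<Longrightarrow> g k = 0" for g :: "int \<Rightarrow> 'b::comm_monoid_add"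
  proof -
    have "sum g {- int n..int n} = sum g {0, int n, - int n}"
      by (intro sum.mono_neutral_right ballI that) (auto simp: \<theta>_def)
    also have "\<dots> = g 0 + g (int n) + g (- int n)"
      using \<open>n \<ge> 1\<close> by (simp add: ac_simps)
    finally show ?thesis .
  qed
  show "\<theta> k = cnj (\<theta> (- k))" for k
    by (simp add: \<theta>_def)
  show "\<theta> k = 0" if "\<bar>k\<bar> > int n" for k
    using that by (auto simp: \<theta>_def)
  have W: "W \<ge> 1" "W = ((1 + real n) powr \<beta>)\<^sup>2"
  proof -
    show "W \<ge> 1"
      unfolding W_def using \<open>\<beta> \<ge> 0\<close> by (intro ge_one_powr_ge_zero) auto
    show "W = ((1 + real n) powr \<beta>)\<^sup>2"
      using powr_add[of "1 + real n" \<beta> \<beta>] by (simp add: W_def power2_eq_square)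
  qed
  have "(\<Sum>k\<in>{- int n..int n}. (1 + \<bar>of_int k\<bar>) powr (2 * \<beta>) * (cmod (\<theta> k))\<^sup>2)
      = c\<^sup>2 + W * c\<^sup>2 / 2"
    using \<open>n \<ge> 1\<close>
    by (subst supp) (auto simp: \<theta>_def W_def norm_divide power_divide)
  \<comment> \<open>The factor 4 comes from squaring the 2 in the denominator of \<open>c\<close>;
    \<open>W \<ge> 1\<close> absorbs the constant term.\<close>
  also have "\<dots> \<le> 4 * W * c\<^sup>2"
    using mult_right_mono[OF W(1), of "c\<^sup>2"] zero_le_power2[of c] by linarith
  also have "\<dots> = L\<^sup>2"
    using W by (simp add: c_def power_divide power_mult_distrib)
  finally show "(\<Sum>k\<in>{- int n..int n}. (1 + \<bar>of_int k\<bar>) powr (2 * \<beta>) * (cmod (\<theta> k))\<^sup>2) \<le> L\<^sup>2" .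
  show "fourier_partial \<theta> n x = of_real (c * (1 - cos (2 * pi * real n * x)))" for x
  proof -
    have "fourier_partial \<theta> n x
        = of_real c - of_real c / 2 * (fourier_e (int n) x + fourier_e (- int n) x)"
      using \<open>n \<ge> 1\<close> unfolding fourier_partial_def
      by (subst supp) (auto simp: \<theta>_def fourier_e_def algebra_simps)
    then show ?thesis
      by (simp add: fourier_e_add_uminus algebra_simps)
  qed
qed

lemma integral_bump:
  fixes c :: real
  assumes "n \<ge> 1"
  shows "(LINT s:{0..1}|lborel. c * (1 - cos (2 * pi * real n * s))) = c"
proof -
  \<comment> \<open>An antiderivative with \<open>F 0 = 0\<close> and \<open>F 1 = c\<close>: the
    cosine runs through n full periods.\<close>
  define F where "F s = c * (s - sin (2 * pi * real n * s) / (2 * pi * real n))" for s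
  have "(F has_vector_derivative c * (1 - cos (2 * pi * real n * x))) (at x within {0..1})" for x
    unfolding F_def has_real_derivative_iff_has_vector_derivative[symmetric] using assms
    by (auto intro!: derivative_eq_intros)
  then have "(LINT s:{0..1}|lborel. c * (1 - cos (2 * pi * real n * s))) = F 1 - F 0"
    unfolding set_lebesgue_integral_def
    by (intro integral_FTC_atLeastAtMost continuous_intros) auto
  moreover have "sin (2 * pi * real n) = 0"
    using sin_npi[of "2 * n"] by (simp add: mult_ac)
  ultimately show ?thesis
    by (simp add: F_def)
qed

section \<open>The lower bound for Sobolev ellipsoids\<close>

lemma deficiency_sobolev_ge_half:
  assumes "brownian_bridge M \<Xi>" and "\<beta> \<ge> 0" and "L > 0" and "n \<ge> 1"
  shows "ennreal (1 / 2) \<le> deficiency (regression_experiment M \<Xi> n (sobolev_ellipsoid \<beta> L))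
    (continuous_experiment M \<Xi> n (sobolev_ellipsoid \<beta> L))"
proof (rule deficiency_ge_half_if_integrals_differ)
  let ?c = "L / (2 * (1 + real n) powr \<beta>)"
  let ?f0 = "\<lambda>x\<in>{0..1::real}. 0 :: real"
  let ?f1 = "\<lambda>x\<in>{0..1}. ?c * (1 - cos (2 * pi * real n * x))"
  show "?f0 \<in> sobolev_ellipsoid \<beta> L" "?f1 \<in> sobolev_ellipsoid \<beta> L"
    using assms by (intro zero_in_sobolev_ellipsoid bump_in_sobolev_ellipsoid; simp)+
  show "?f0 (real i / real n) = ?f1 (real i / real n)" if "i \<in> {1..n}" for i
  proof -
    \<comment> \<open>The argument reduces to 2 * pi * i, so the bump vanishes at each design
      point.\<close>
    have "cos (2 * pi * real n * (real i / real n)) = 1"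
      using cos_npi[of "2 * i"] \<open>n \<ge> 1\<close> by (simp add: mult_ac)
    then show ?thesis
      by (simp add: restrict_def)
  qed
  show "continuous_on {0..1} ?f0"
    by (rule continuous_on_eq[OF continuous_on_const]) simp
  have "continuous_on {0..1} (\<lambda>x. ?c * (1 - cos (2 * pi * real n * x)))"
    by (intro continuous_intros)
  then show "continuous_on {0..1} ?f1"
    by (rule continuous_on_eq) simp
  have "(LINT s:{0..1}|lborel. ?f0 s) = (LINT s:{0..1::real}|lborel. 0)"
    by (rule set_lebesgue_integral_cong) auto
  moreover have "(LINT s:{0..1}|lborel. ?f1 s)
      = (LINT s:{0..1}|lborel. ?c * (1 - cos (2 * pi * real n * s)))"
    by (rule set_lebesgue_integral_cong) auto
  \<comment> \<open>The integrals are 0 and \<open>?c\<close>, and \<open>?c\<close> is nonzero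
    because \<open>L > 0\<close>.\<close>
  ultimately show "(LINT s:{0..1}|lborel. ?f0 s) \<noteq> (LINT s:{0..1}|lborel. ?f1 s)"
    using integral_bump[OF \<open>n \<ge> 1\<close>, of ?c] \<open>L > 0\<close> by simp
qed (use assms in auto)

theorem theorem4p6:
  fixes M :: "'a measure" and \<Xi> :: "real \<Rightarrow> 'a \<Rightarrow> real" and \<beta> L :: real
  assumes "brownian_bridge M \<Xi>"
    and "\<beta> > 0"
    and "L > 0"
  shows "(\<forall>n::nat. n \<ge> 1 \<longrightarrow>
            deficiency (regression_experiment M \<Xi> n (sobolev_ellipsoid \<beta> L))
                       (continuous_experiment M \<Xi> n (sobolev_ellipsoid \<beta> L)) \<ge> 1 / 4)
       \<and> \<not> (\<lambda>n. le_cam_dist (regression_experiment M \<Xi> n (sobolev_ellipsoid \<beta> L))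
                            (continuous_experiment M \<Xi> n (sobolev_ellipsoid \<beta> L)))
              \<longlonglongrightarrow> 0"
proof (intro conjI allI impI notI)
  let ?E = "\<lambda>n. regression_experiment M \<Xi> n (sobolev_ellipsoid \<beta> L)"
  let ?F = "\<lambda>n. continuous_experiment M \<Xi> n (sobolev_ellipsoid \<beta> L)"
  have half: "ennreal (1 / 2) \<le> deficiency (?E n) (?F n)" if "n \<ge> 1" for n
    using assms that by (intro deficiency_sobolev_ge_half) auto
  \<comment> \<open>The quotient in the claim is taken in \<open>ennreal\<close> and must first be
    matched with the real number 1/4.\<close>
  have "(1 / 4 :: ennreal) = ennreal (1 / 4)"
    by (metis divide_ennreal ennreal_1 ennreal_numeral zero_le_numeral zero_le_one zero_less_numeral)
  also have "\<dots> \<le> ennreal (1 / 2)"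
    by (rule ennreal_leI) simp
  finally show "1 / 4 \<le> deficiency (?E n) (?F n)" if "n \<ge> 1" for n
    using half[OF that] by (rule order_trans)
  assume "(\<lambda>n. le_cam_dist (?E n) (?F n)) \<longlonglongrightarrow> 0"
  \<comment> \<open>A uniform lower bound from n = 1 on would pass to the limit 0.\<close>
  moreover have "\<forall>n\<ge>1. ennreal (1 / 2) \<le> le_cam_dist (?E n) (?F n)"
    unfolding le_cam_dist_def using half by (blast intro: max.coboundedI1)
  ultimately have "ennreal (1 / 2) \<le> 0"
    by (rule Lim_bounded2)
  then show False
    by simp
qed

end
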